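(* Consider the optimization problem $$\underset{\mathbf{\Phi}}{\text{minimize}}\quad g(\mathbf{\Phi})\qquad\text{subject to}\quad \mathbf{\Phi}\in\mathcal{S},$$ where $\mathbf{\Phi}$ is an $m\times n$ transfer matrix, $g(\cdot)$ is a functional objective, and $\mathcal{S}$ is a set constraint. Let $\{\mathcal{c}_1,\dots,\mathcal{c}_p\}$ be a partition of the set $\{1,\dots,n\}$. Assume that the objective $g$ and the set constraint $\mathcal{S}$ are both column-wise separable with respect to the column-wise partition $\{\mathcal{c}_1,\dots,\mathcal{c}_p\}$, with corresponding functionals $g_1,\dots,g_p$ and sets $\mathcal{S}_1,\dots,\mathcal{S}_p$ (in this case the optimization problem is called a column-wise separable problem). Then the optimization problem can be partitioned into $p$ parallel subproblems as $$\underset{\mathbf{\Phi}(:,\mathcal{c}_j)}{\text{minimize}}\quad g_j(\mathbf{\Phi}(:,\mathcal{c}_j))\qquad\text{subject to}\quad \mathbf{\Phi}(:,\mathcal{c}_j)\in\mathcal{S}_j$$ for $j=1,\dots,p$.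
   Context: For a transfer matrix $\mathbf{\Phi}$ with $n$ columns and a subset $\mathcal{c}\subseteq\{1,\dots,n\}$, $\mathbf{\Phi}(:,\mathcal{c})$ denotes the submatrix of $\mathbf{\Phi}$ obtained by selecting all rows and the columns indexed by $\mathcal{c}$. A partition $\{\mathcal{c}_1,\dots,\mathcal{c}_p\}$ of $\{1,\dots,n\}$ gives the column-wise partition $\{\mathbf{\Phi}(:,\mathcal{c}_1),\dots,\mathbf{\Phi}(:,\mathcal{c}_p)\}$ of $\mathbf{\Phi}$. Column-wise separable objective: the functional objective $g(\mathbf{\Phi})$ is said to be column-wise separable with respect to the column-wise partition $\{\mathcal{c}_1,\dots,\mathcal{c}_p\}$ if $g(\mathbf{\Phi})=\sum_{j=1}^p g_j(\mathbf{\Phi}(:,\mathcal{c}_j))$ for some functionals $g_j(\cdot)$, $j=1,\dots,p$. Column-wise separable constraint: the set constraint $\mathcal{S}$ is said to be column-wise separable with respect to the column-wise partition $\{\mathcal{c}_1,\dots,\mathcal{c}_p\}$ if, for some sets $\mathcal{S}_j$, $j=1,\dots,p$, the following condition is satisfied: $\mathbf{\Phi}\in\mathcal{S}$ if and only if $\mathbf{\Phi}(:,\mathcal{c}_j)\in\mathcal{S}_j$ for $j=1,\dots,p$. *)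

theory Defs
  imports
    Jordan_Normal_Form.DL_Submatrix
    "HOL-Library.Disjoint_Sets"
    "HOL-Library.FuncSet"
    "HOL-Library.Extended_Real"
begin

text \<open>
  The type \<open>'tf\<close> of transfer functions is a parameter: column-wise separability does not depend on
  the model of a transfer function, e.g. real rational functions in \<open>z\<close> (\<open>real poly fract\<close>), or
  causal impulse responses as formal power series in \<open>1/z\<close> (\<open>real fps\<close>).
  A smaller class, such as the stable proper ones, is expressed through the constraint set.
  As usual for \<open>mat\<close>, the columns of an \<open>m \<times> n\<close> matrix are numbered \<open>0, \<dots>, n - 1\<close>.
\<close>

type_synonym 'tf transfer_matrix = "'tf mat"

definition columns :: "'tf transfer_matrix \<Rightarrow> nat set \<Rightarrow> 'tf transfer_matrix" where
  "columns \<Phi> C = submatrix \<Phi> UNIV C"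

text \<open>
  Injectivity makes the parts \<open>c 1, \<dots>, c p\<close> pairwise different, so that they form a
  partition with exactly \<open>p\<close> (nonempty, disjoint) blocks.
\<close>

definition is_column_partition :: "nat \<Rightarrow> nat \<Rightarrow> (nat \<Rightarrow> nat set) \<Rightarrow> bool" where
  "is_column_partition n p c \<longleftrightarrow> inj_on c {1..p} \<and> partition_on {0..<n} (c ` {1..p})"

definition column_separable_objective ::
  "nat \<Rightarrow> nat \<Rightarrow> nat \<Rightarrow> (nat \<Rightarrow> nat set) \<Rightarrow> ('tf transfer_matrix \<Rightarrow> real)
    \<Rightarrow> (nat \<Rightarrow> 'tf transfer_matrix \<Rightarrow> real) \<Rightarrow> bool" where
  "column_separable_objective m n p c g gs \<longleftrightarrow>
    (\<forall>\<Phi> \<in> carrier_mat m n. g \<Phi> = (\<Sum>j = 1..p. gs j (columns \<Phi> (c j))))"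

definition column_separable_constraint ::
  "nat \<Rightarrow> nat \<Rightarrow> nat \<Rightarrow> (nat \<Rightarrow> nat set) \<Rightarrow> 'tf transfer_matrix set
    \<Rightarrow> (nat \<Rightarrow> 'tf transfer_matrix set) \<Rightarrow> bool" where
  "column_separable_constraint m n p c S Ss \<longleftrightarrow>
    (\<forall>\<Phi> \<in> carrier_mat m n. \<Phi> \<in> S \<longleftrightarrow> (\<forall>j \<in> {1..p}. columns \<Phi> (c j) \<in> Ss j))"

definition is_optimal_solution :: "('a \<Rightarrow> real) \<Rightarrow> 'a set \<Rightarrow> 'a \<Rightarrow> bool" where
  "is_optimal_solution f F x \<longleftrightarrow> is_arg_min f (\<lambda>y. y \<in> F) x"

text \<open>
  The optimal value is \<open>\<infinity>\<close> for an infeasible and \<open>-\<infinity>\<close> for an unbounded problem. Sums of optimal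
  values follow the convention of \<open>ereal\<close> that \<open>\<infinity> + (-\<infinity>) = \<infinity>\<close>, the usual one for minimization:
  one infeasible subproblem makes the whole problem infeasible.
\<close>

definition optimal_value :: "('a \<Rightarrow> real) \<Rightarrow> 'a set \<Rightarrow> ereal" where
  "optimal_value f F = (INF x\<in>F. ereal (f x))"

end

theory Submission
  imports Defs
begin

text \<open>
  The proof separates a fact about matrices from a fact about minimization.

  Cutting an \<open>m \<times> n\<close> matrix along a partition of its column indices loses no information and
  imposes no compatibility condition on the blocks: every column lies in exactly one block, so any
  blocks of the right dimensions can be glued together, in exactly one way
  (\<open>bij_betw_column_blocks\<close>). Under this bijection a separable constraint becomes a product set
  and a separable objective becomes a sum in which the \<open>j\<close>-th summand sees only the \<open>j\<close>-th
  coordinate.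

  For such a sum over a product, the coordinates can be chosen independently. A point is therefore
  a minimizer precisely when each coordinate is a minimizer, since a single coordinate can be
  improved while the others stay fixed (\<open>is_optimal_solution_PiE\<close>), and the infimum is
  the sum of the infima (\<open>optimal_value_PiE\<close>). Optimal values and minimizers are
  then carried back along the bijection.
\<close>

section \<open>Minimizing a separable sum over a product\<close>

lemma optimal_value_less_iff:
  "optimal_value f F < ereal b \<longleftrightarrow> (\<exists>x\<in>F. f x < b)"
  by (simp add: optimal_value_def INF_less_iff)

lemma optimal_value_lower: "x \<in> F \<Longrightarrow> optimal_value f F \<le> ereal (f x)"
  unfolding optimal_value_def by (rule INF_lower)

lemma optimal_value_empty: "optimal_value f {} = \<infinity>"
  by (simp add: optimal_value_def top_ereal_def)

lemma optimal_value_less_PInfty: "F \<noteq> {} \<Longrightarrow> optimal_value f F < \<infinity>"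
proof -
  assume "F \<noteq> {}"
  then obtain x where "x \<in> F" by blast
  then have "optimal_value f F \<le> ereal (f x)" by (rule optimal_value_lower)
  also have "\<dots> < \<infinity>" by simp
  finally show ?thesis .
qed

text \<open>
  Working with strict real upper bounds of the infima, instead of approximating each infimum up to
  some \<open>\<epsilon>\<close>, treats the values \<open>-\<infinity>\<close> and the finite ones uniformly.
\<close>

lemma ereal_add_less_split:
  fixes u v :: ereal
  assumes "u < \<infinity>" "v < \<infinity>" "u + v < ereal b"
  obtains r s where "u < ereal r" "v < ereal s" "r + s \<le> b"
proof (cases u)
  case (real u')
  then have "v < ereal (b - u')"
    using assms by (cases v) auto
  then obtain s where s: "v < ereal s" "ereal s < ereal (b - u')"
    using ereal_dense2 by blast
  show thesis
  proof (rule that[of "b - s" s])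
    show "u < ereal (b - s)" using s(2) real by simp
  qed (use s(1) in simp_all)
next
  case PInf
  then show thesis using assms by simp
next
  case MInf
  obtain s where s: "v < ereal s"
    using assms(2) ereal_dense2 by blast
  show thesis
  proof (rule that[of "b - s" s])
    show "u < ereal (b - s)" using MInf by simp
  qed (use s in simp_all)
qed

lemma ereal_sum_less_split:
  fixes v :: "'i \<Rightarrow> ereal"
  assumes "finite I" "\<And>j. j \<in> I \<Longrightarrow> v j < \<infinity>" "(\<Sum>j\<in>I. v j) < ereal b"
  shows "\<exists>r. (\<forall>j\<in>I. v j < ereal (r j)) \<and> (\<Sum>j\<in>I. r j) \<le> b"
  using assms
proof (induction I arbitrary: b rule: finite_induct)
  case empty
  then show ?case by simp
next
  case (insert a I)
  have "(\<Sum>j\<in>I. v j) \<noteq> \<infinity>"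
    using insert.prems(1) by (subst sum_Pinfty) force
  then have "(\<Sum>j\<in>I. v j) < \<infinity>" by simp
  moreover have "v a < \<infinity>" "v a + (\<Sum>j\<in>I. v j) < ereal b"
    using insert by auto
  ultimately obtain s t
    where st: "v a < ereal s" "(\<Sum>j\<in>I. v j) < ereal t" "s + t \<le> b"
    using ereal_add_less_split by metis
  obtain r where r: "\<forall>j\<in>I. v j < ereal (r j)" "(\<Sum>j\<in>I. r j) \<le> t"
    using insert.IH[of t] insert.prems(1) st(2) by auto
  have "(\<Sum>j\<in>I. (r(a := s)) j) = (\<Sum>j\<in>I. r j)"
    using insert.hyps by (intro sum.cong) auto
  then show ?case
    using insert.hyps r st by (intro exI[of _ "r(a := s)"]) auto
qed

text \<open>
  An infeasible factor makes the whole product infeasible, which matches the right-hand side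
  because \<open>\<infinity>\<close> absorbs \<open>-\<infinity>\<close> in sums. If all factors are feasible, no infimum is \<open>\<infinity>\<close>, so a bound
  above the sum of the infima splits into bounds above the single infima; points beating these
  form a point of the product.
\<close>

lemma optimal_value_PiE:
  assumes "finite I"
  shows "optimal_value (\<lambda>x. \<Sum>j\<in>I. f j (x j)) (\<Pi>\<^sub>E j\<in>I. F j) = (\<Sum>j\<in>I. optimal_value (f j) (F j))"
    (is "?L = ?R")
proof (cases "\<exists>j\<in>I. F j = {}")
  case True
  then have "(\<Pi>\<^sub>E j\<in>I. F j) = {}"
    by (simp add: PiE_eq_empty_iff)
  moreover have "?R = \<infinity>"
    using True assms optimal_value_empty unfolding sum_Pinfty by metis
  ultimately show ?thesis
    by (simp add: optimal_value_empty)
next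
  case False
  have "?R \<le> ?L"
    unfolding optimal_value_def[of _ "\<Pi>\<^sub>E j\<in>I. F j"]
  proof (rule INF_greatest)
    fix x assume "x \<in> (\<Pi>\<^sub>E j\<in>I. F j)"
    then have "?R \<le> (\<Sum>j\<in>I. ereal (f j (x j)))"
      by (intro sum_mono optimal_value_lower) auto
    then show "?R \<le> ereal (\<Sum>j\<in>I. f j (x j))" by simp
  qed
  moreover have "?L \<le> ?R"
  proof (rule ccontr)
    assume "\<not> ?L \<le> ?R"
    then have "?R < ?L" by simp
    then obtain b where b: "?R < ereal b" "ereal b < ?L"
      using ereal_dense2 by blast
    have "optimal_value (f j) (F j) < \<infinity>" if "j \<in> I" for j
      using False that by (intro optimal_value_less_PInfty) blast
    then obtain r where r: "\<forall>j\<in>I. optimal_value (f j) (F j) < ereal (r j)" "(\<Sum>j\<in>I. r j) \<le> b"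
      using ereal_sum_less_split[OF assms _ b(1)] by blast
    then obtain x where x: "\<forall>j\<in>I. x j \<in> F j \<and> f j (x j) < r j"
      unfolding optimal_value_less_iff by metis
    have "?L \<le> ereal (\<Sum>j\<in>I. f j (restrict x I j))"
      using x by (intro optimal_value_lower) auto
    also have "\<dots> \<le> ereal (\<Sum>j\<in>I. r j)"
      using x by (auto intro!: sum_mono simp: less_imp_le)
    also have "\<dots> \<le> ereal b"
      using r by simp
    finally show False using b(2) by simp
  qed
  ultimately show ?thesis by (rule antisym[rotated])
qed

lemma is_optimal_solution_iff:
  "is_optimal_solution f F x \<longleftrightarrow> x \<in> F \<and> (\<forall>y\<in>F. f x \<le> f y)"
  by (auto simp: is_optimal_solution_def is_arg_min_linorder)

lemma is_optimal_solution_PiE: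
  assumes "finite I" "x \<in> extensional I"
  shows "is_optimal_solution (\<lambda>x. \<Sum>j\<in>I. f j (x j)) (\<Pi>\<^sub>E j\<in>I. F j) x \<longleftrightarrow>
    (\<forall>j\<in>I. is_optimal_solution (f j) (F j) (x j))"
proof
  assume opt: "is_optimal_solution (\<lambda>x. \<Sum>j\<in>I. f j (x j)) (\<Pi>\<^sub>E j\<in>I. F j) x"
  show "\<forall>j\<in>I. is_optimal_solution (f j) (F j) (x j)"
    unfolding is_optimal_solution_iff
  proof (intro ballI conjI)
    fix k assume "k \<in> I"
    then show "x k \<in> F k"
      using opt by (auto simp: is_optimal_solution_iff)
    fix y assume "y \<in> F k"
    then have "x(k := y) \<in> (\<Pi>\<^sub>E j\<in>I. F j)"
      using opt \<open>k \<in> I\<close> by (auto simp: is_optimal_solution_iff PiE_iff extensional_def)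
    then have "(\<Sum>j\<in>I. f j (x j)) \<le> (\<Sum>j\<in>I. f j ((x(k := y)) j))"
      using opt by (simp only: is_optimal_solution_iff)
    moreover have "(\<Sum>j\<in>I - {k}. f j ((x(k := y)) j)) = (\<Sum>j\<in>I - {k}. f j (x j))"
      by (intro sum.cong) auto
    ultimately show "f k (x k) \<le> f k y"
      using \<open>k \<in> I\<close> by (simp add: sum.remove[OF assms(1)])
  qed
next
  assume opt: "\<forall>j\<in>I. is_optimal_solution (f j) (F j) (x j)"
  show "is_optimal_solution (\<lambda>x. \<Sum>j\<in>I. f j (x j)) (\<Pi>\<^sub>E j\<in>I. F j) x"
    unfolding is_optimal_solution_iff
  proof (intro conjI ballI)
    show "x \<in> (\<Pi>\<^sub>E j\<in>I. F j)"
      using opt assms(2) by (simp add: is_optimal_solution_iff PiE_iff)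
    show "(\<Sum>j\<in>I. f j (x j)) \<le> (\<Sum>j\<in>I. f j (y j))" if "y \<in> (\<Pi>\<^sub>E j\<in>I. F j)" for y
      using opt that by (intro sum_mono) (simp add: is_optimal_solution_iff PiE_iff)
  qed
qed

section \<open>Change of variables in a minimization problem\<close>

lemma optimal_value_bij_betw:
  assumes "bij_betw h A B" "\<And>a. a \<in> A \<Longrightarrow> g a = f (h a)"
  shows "optimal_value g A = optimal_value f B"
proof -
  have "(\<lambda>x. ereal (g x)) ` A = (\<lambda>y. ereal (f y)) ` B"
    unfolding bij_betw_imp_surj_on[OF assms(1), symmetric] image_image
    using assms(2) by (intro image_cong) simp_all
  then show ?thesis unfolding optimal_value_def by (rule arg_cong)
qed

lemma is_optimal_solution_bij_betw:
  assumes "bij_betw h A B" "\<And>a. a \<in> A \<Longrightarrow> g a = f (h a)" "a \<in> A"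
  shows "is_optimal_solution g A a \<longleftrightarrow> is_optimal_solution f B (h a)"
proof -
  have "h ` A = B" using assms(1) by (rule bij_betw_imp_surj_on)
  then show ?thesis
    unfolding is_optimal_solution_iff \<open>h ` A = B\<close>[symmetric] using assms(2,3) by simp
qed

section \<open>Cutting a matrix into column blocks\<close>

lemma columns_eq_mat:
  assumes "\<Phi> \<in> carrier_mat m n" "C \<subseteq> {0..<n}"
  shows "columns \<Phi> C = mat m (card C) (\<lambda>(i, k). \<Phi> $$ (i, pick C k))"
proof -
  have "dim_row \<Phi> = m" "dim_col \<Phi> = n" using assms(1) by (rule carrier_matD)+
  moreover have "{j. j < n \<and> j \<in> C} = C" using assms(2) by fastforce
  moreover have "card {i. i < m \<and> i \<in> UNIV} = m" by simp
  ultimately show ?thesis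
    unfolding columns_def submatrix_def pick_UNIV by (simp only:)
qed

lemma columns_carrier:
  assumes "\<Phi> \<in> carrier_mat m n" "C \<subseteq> {0..<n}"
  shows "columns \<Phi> C \<in> carrier_mat m (card C)"
  unfolding columns_eq_mat[OF assms] by (rule mat_carrier)

lemma columns_index:
  assumes "\<Phi> \<in> carrier_mat m n" "C \<subseteq> {0..<n}" "i < m" "k < card C"
  shows "columns \<Phi> C $$ (i, k) = \<Phi> $$ (i, pick C k)"
  unfolding columns_eq_mat[OF assms(1,2)] index_mat(1)[OF assms(3,4)] by (rule prod.case)

lemma columns_index_card:
  assumes "\<Phi> \<in> carrier_mat m n" "i < m" "k < n" "k \<in> C"
  shows "columns \<Phi> C $$ (i, card {a\<in>C. a < k}) = \<Phi> $$ (i, k)"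
proof -
  have "submatrix \<Phi> UNIV C $$ (card {a\<in>UNIV. a < i}, card {a\<in>C. a < k}) = \<Phi> $$ (i, k)"
    using assms by (intro submatrix_index_card) auto
  moreover have "card {a\<in>UNIV. a < i} = i" by simp
  ultimately show ?thesis unfolding columns_def by (simp only:)
qed

lemma column_partition_unique_block:
  assumes "is_column_partition n p c"
  shows "j \<in> {1..p} \<Longrightarrow> c j \<subseteq> {0..<n}"
    and "k < n \<Longrightarrow> \<exists>j\<in>{1..p}. k \<in> c j"
    and "i \<in> {1..p} \<Longrightarrow> j \<in> {1..p} \<Longrightarrow> k \<in> c i \<Longrightarrow> k \<in> c j \<Longrightarrow> i = j"
proof -
  have un: "(\<Union>j\<in>{1..p}. c j) = {0..<n}" and disj: "disjoint (c ` {1..p})" and inj: "inj_on c {1..p}"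
    using assms by (auto simp: is_column_partition_def partition_on_def)
  show "c j \<subseteq> {0..<n}" if "j \<in> {1..p}"
    using un that by blast
  have "k \<in> (\<Union>j\<in>{1..p}. c j)" if "k < n"
    unfolding un using that by simp
  then show "\<exists>j\<in>{1..p}. k \<in> c j" if "k < n"
    using that by blast
  show "i = j" if "i \<in> {1..p}" "j \<in> {1..p}" "k \<in> c i" "k \<in> c j"
    using disjointD[OF disj, of "c i" "c j"] inj_onD[OF inj, of i j] that by blast
qed

text \<open>
  Column \<open>k\<close> of the glued matrix is read off from the unique block containing \<open>k\<close>, at the position
  given by the number of smaller indices in that block; this position inverts the increasing
  enumeration \<open>pick\<close> of the block.
\<close>

lemma bij_betw_column_blocks:
  assumes part: "is_column_partition n p c"
  shows "bij_betw (\<lambda>\<Phi>. \<lambda>j\<in>{1..p}. columns \<Phi> (c j))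
    (carrier_mat m n) (\<Pi>\<^sub>E j\<in>{1..p}. carrier_mat m (card (c j)))"
    (is "bij_betw ?cut _ ?blocks")
proof (rule bij_betw_imageI)
  note block = column_partition_unique_block[OF part]
  show "inj_on ?cut (carrier_mat m n)"
  proof (rule inj_onI)
    fix \<Phi> \<Psi> :: "'a mat"
    assume carr: "\<Phi> \<in> carrier_mat m n" "\<Psi> \<in> carrier_mat m n" and eq: "?cut \<Phi> = ?cut \<Psi>"
    show "\<Phi> = \<Psi>"
    proof (rule eq_matI)
      fix i k assume "i < dim_row \<Psi>" "k < dim_col \<Psi>"
      then have ik: "i < m" "k < n" using carr by auto
      then obtain j where j: "j \<in> {1..p}" "k \<in> c j"
        using block(2)[OF ik(2)] by blast
      have "columns \<Phi> (c j) = columns \<Psi> (c j)"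
        using fun_cong[OF eq, of j] j(1) by simp
      then show "\<Phi> $$ (i, k) = \<Psi> $$ (i, k)"
        using columns_index_card[OF carr(1), of i k "c j"] columns_index_card[OF carr(2), of i k "c j"]
          ik j by simp
    qed (use carr in auto)
  qed
  show "?cut ` carrier_mat m n = ?blocks"
  proof (intro subset_antisym subsetI)
    show "X \<in> ?blocks" if "X \<in> ?cut ` carrier_mat m n" for X
      using that columns_carrier[OF _ block(1)] by (auto simp del: atLeastAtMost_iff)
    fix X :: "nat \<Rightarrow> 'a mat" assume X: "X \<in> ?blocks"
    obtain blk where blk: "blk k \<in> {1..p} \<and> k \<in> c (blk k)" if "k < n" for k
      using block(2) by metis
    define \<Phi> where "\<Phi> = mat m n (\<lambda>(i, k). X (blk k) $$ (i, card {a\<in>c (blk k). a < k}))"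
    have carr: "\<Phi> \<in> carrier_mat m n" by (simp add: \<Phi>_def)
    have "columns \<Phi> (c j) = X j" if j: "j \<in> {1..p}" for j
    proof (rule eq_matI)
      have Xj: "X j \<in> carrier_mat m (card (c j))" using X j by (rule PiE_mem)
      show "dim_row (columns \<Phi> (c j)) = dim_row (X j)" "dim_col (columns \<Phi> (c j)) = dim_col (X j)"
        using columns_carrier[OF carr block(1)[OF j]] Xj by auto
      fix i l assume "i < dim_row (X j)" "l < dim_col (X j)"
      then have i: "i < m" and l: "l < card (c j)" using Xj by auto
      let ?k = "pick (c j) l"
      have k: "?k \<in> c j" and card_k: "card {a\<in>c j. a < ?k} = l"
        using l by (auto intro: pick_in_set_le card_pick_le)
      then have kn: "?k < n" using block(1)[OF j] by auto
      then have "blk ?k = j" using blk[of ?k] block(3) j k by blast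
      then have "\<Phi> $$ (i, ?k) = X j $$ (i, l)"
        using i kn card_k by (simp add: \<Phi>_def)
      then show "columns \<Phi> (c j) $$ (i, l) = X j $$ (i, l)"
        using columns_index[OF carr block(1)[OF j] i l] by simp
    qed
    then have "?cut \<Phi> = X"
      using X by (intro PiE_ext[of _ "{1..p}" "\<lambda>j. carrier_mat m (card (c j))"])
        (auto simp: PiE_iff)
    then show "X \<in> ?cut ` carrier_mat m n" using carr by blast
  qed
qed

lemma bij_betw_vimage_restrict:
  assumes "bij_betw h A B" "A' \<subseteq> A" "B' \<subseteq> B" "\<And>a. a \<in> A \<Longrightarrow> a \<in> A' \<longleftrightarrow> h a \<in> B'"
  shows "bij_betw h A' B'"
proof (rule bij_betw_subset[OF assms(1,2)])
  have "h ` A = B" using assms(1) by (rule bij_betw_imp_surj_on)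
  show "h ` A' = B'"
  proof (intro subset_antisym subsetI)
    show "b \<in> B'" if "b \<in> h ` A'" for b
      using that assms(2,4) by auto
    fix b assume "b \<in> B'"
    then obtain a where "a \<in> A" "b = h a" using assms(3) \<open>h ` A = B\<close> by blast
    then show "b \<in> h ` A'" using assms(4) \<open>b \<in> B'\<close> by simp
  qed
qed

section \<open>Decomposition of a column-wise separable problem\<close>

theorem mainTheorem1:
  fixes m n p :: nat
    and c :: "nat \<Rightarrow> nat set"
    and g :: "'tf transfer_matrix \<Rightarrow> real"
    and gs :: "nat \<Rightarrow> 'tf transfer_matrix \<Rightarrow> real"
    and S :: "'tf transfer_matrix set"
    and Ss :: "nat \<Rightarrow> 'tf transfer_matrix set"
  assumes "is_column_partition n p c"
    and "S \<subseteq> carrier_mat m n"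
    and "\<And>j. j \<in> {1..p} \<Longrightarrow> Ss j \<subseteq> carrier_mat m (card (c j))"
    and "column_separable_objective m n p c g gs"
    and "column_separable_constraint m n p c S Ss"
  shows "bij_betw (\<lambda>\<Phi>. \<lambda>j\<in>{1..p}. columns \<Phi> (c j)) S (\<Pi>\<^sub>E j\<in>{1..p}. Ss j)
    \<and> optimal_value g S = (\<Sum>j = 1..p. optimal_value (gs j) (Ss j))
    \<and> (\<forall>\<Phi> \<in> carrier_mat m n. is_optimal_solution g S \<Phi> \<longleftrightarrow>
          (\<forall>j\<in>{1..p}. is_optimal_solution (gs j) (Ss j) (columns \<Phi> (c j))))
    \<and> (\<forall>X. (\<forall>j\<in>{1..p}. is_optimal_solution (gs j) (Ss j) (X j)) \<longrightarrow>
          (\<exists>!\<Phi>. \<Phi> \<in> carrier_mat m n \<and> (\<forall>j\<in>{1..p}. columns \<Phi> (c j) = X j)) \<and>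
          (\<forall>\<Phi> \<in> carrier_mat m n. (\<forall>j\<in>{1..p}. columns \<Phi> (c j) = X j)
             \<longrightarrow> is_optimal_solution g S \<Phi>))"
proof -
  let ?I = "{1..p}"
  let ?cut = "\<lambda>\<Phi>. \<lambda>j\<in>?I. columns \<Phi> (c j)"
  let ?f = "\<lambda>x. \<Sum>j\<in>?I. gs j (x j)"
  note cut = bij_betw_column_blocks[OF assms(1), where m = m]
  have S_iff: "\<Phi> \<in> S \<longleftrightarrow> ?cut \<Phi> \<in> (\<Pi>\<^sub>E j\<in>?I. Ss j)" if "\<Phi> \<in> carrier_mat m n" for \<Phi>
    using assms(5) that by (auto simp: column_separable_constraint_def PiE_iff)
  have bij: "bij_betw ?cut S (\<Pi>\<^sub>E j\<in>?I. Ss j)"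
    using cut assms(2) PiE_mono[OF assms(3)] S_iff by (rule bij_betw_vimage_restrict)
  have g: "g \<Phi> = ?f (?cut \<Phi>)" if "\<Phi> \<in> S" for \<Phi>
    using assms(2,4) that by (auto simp: column_separable_objective_def)
  have val: "optimal_value g S = (\<Sum>j = 1..p. optimal_value (gs j) (Ss j))"
    using optimal_value_bij_betw[OF bij, of g ?f] g by (simp only: optimal_value_PiE finite_atLeastAtMost)
  have sol: "is_optimal_solution g S \<Phi> \<longleftrightarrow>
      (\<forall>j\<in>?I. is_optimal_solution (gs j) (Ss j) (columns \<Phi> (c j)))"
    if carr: "\<Phi> \<in> carrier_mat m n" for \<Phi>
  proof (cases "\<Phi> \<in> S")
    case True
    have "is_optimal_solution g S \<Phi> \<longleftrightarrow> is_optimal_solution ?f (\<Pi>\<^sub>E j\<in>?I. Ss j) (?cut \<Phi>)"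
      using is_optimal_solution_bij_betw[OF bij, of g ?f \<Phi>] g True by blast
    also have "\<dots> \<longleftrightarrow> (\<forall>j\<in>?I. is_optimal_solution (gs j) (Ss j) (?cut \<Phi> j))"
      by (intro is_optimal_solution_PiE finite_atLeastAtMost restrict_extensional)
    finally show ?thesis by simp
  next
    case False
    then show ?thesis
      using S_iff[OF carr] by (auto simp: is_optimal_solution_iff PiE_iff)
  qed
  have glue: "\<exists>!\<Phi>. \<Phi> \<in> carrier_mat m n \<and> (\<forall>j\<in>?I. columns \<Phi> (c j) = X j)"
    if X: "\<forall>j\<in>?I. is_optimal_solution (gs j) (Ss j) (X j)" for X
  proof -
    have "restrict X ?I \<in> (\<Pi>\<^sub>E j\<in>?I. carrier_mat m (card (c j)))"
      using X assms(3) by (auto simp: is_optimal_solution_iff simp del: atLeastAtMost_iff)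
    then have "\<exists>!\<Phi>. \<Phi> \<in> carrier_mat m n \<and> ?cut \<Phi> = restrict X ?I"
      using cut unfolding bij_betw_iff_bijections by metis
    moreover have "?cut \<Phi> = restrict X ?I \<longleftrightarrow> (\<forall>j\<in>?I. columns \<Phi> (c j) = X j)" for \<Phi>
      by (auto simp: fun_eq_iff restrict_def)
    ultimately show ?thesis by simp
  qed
  show ?thesis
    using bij val sol glue by auto
qed

end
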